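(* Let $n\ge 1$, let $f:\{0,1\}^n\to\mathbb{R}$, and let $0<p<r<1$. Then $$ \mathrm{Var}_r\big(\mathbb{E}_{p/r}\big[f(\psi\cdot\xi)\,\big|\,\psi\big]\big)\;\le\;\frac{p}{r}\,\frac{1-r}{1-p}\,\mathrm{Var}_p(f). $$
   Context: For $q\in[0,1]$, $\mathbb{P}_q$ is the product measure on $\{0,1\}^n$ giving each coordinate the value $1$ with probability $q$ and $0$ with probability $1-q$; $\mathbb{E}_q$ and $\mathrm{Var}_q$ are expectation and variance with respect to $\mathbb{P}_q$. The configurations $\psi,\xi\in\{0,1\}^n$ are independent, with $\psi\sim\mathbb{P}_r$ and $\xi\sim\mathbb{P}_{p/r}$, and $\psi\cdot\xi$ is the coordinate-wise product. Thus $\mathbb{E}_{p/r}[f(\psi\cdot\xi)\,|\,\psi]$ is the function of $\psi$ obtained by averaging over $\xi\sim\mathbb{P}_{p/r}$ with $\psi$ fixed, and $\mathrm{Var}_r$ of it is taken over $\psi\sim\mathbb{P}_r$. *)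

theory Defs
  imports "HOL-Probability.Probability" "HOL-Probability.Product_PMF"
begin

text \<open>
  A finite index type \<open>'n\<close> stands for \<open>{1, ..., n}\<close> with \<open>n = CARD('n) \<ge> 1\<close>.
  The truth values \<open>False\<close> and \<open>True\<close> stand for \<open>0\<close> and \<open>1\<close>.
\<close>

type_synonym 'n config = "'n \<Rightarrow> bool"

text \<open>
  The default value \<open>False\<close> is irrelevant here, since the index set of the product is \<open>UNIV\<close>.
  Outside \<open>[0, 1]\<close>, \<open>bernoulli_pmf\<close> clamps its parameter.
\<close>

definition prod_bernoulli :: "real \<Rightarrow> ('n::finite) config pmf" where
  "prod_bernoulli q = Pi_pmf UNIV False (\<lambda>_. bernoulli_pmf q)"

abbreviation E_prod :: "real \<Rightarrow> (('n::finite) config \<Rightarrow> real) \<Rightarrow> real" where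
  "E_prod q g \<equiv> measure_pmf.expectation (prod_bernoulli q) g"

abbreviation Var_prod :: "real \<Rightarrow> (('n::finite) config \<Rightarrow> real) \<Rightarrow> real" where
  "Var_prod q g \<equiv> measure_pmf.variance (prod_bernoulli q) g"

text \<open>On \<open>{0, 1}\<close>, multiplication is conjunction.\<close>

definition config_mult :: "'n config \<Rightarrow> 'n config \<Rightarrow> 'n config" where
  "config_mult \<psi> \<xi> = (\<lambda>i. \<psi> i \<and> \<xi> i)"

text \<open>
  As \<open>\<psi>\<close> and \<open>\<xi>\<close> are independent, the conditional expectation of \<open>f (\<psi> \<cdot> \<xi>)\<close> given \<open>\<psi>\<close>,
  with \<open>\<xi>\<close> distributed as \<open>prod_bernoulli s\<close>, is the average over \<open>\<xi>\<close> with \<open>\<psi>\<close> held fixed.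
\<close>

definition cond_E_mult :: "real \<Rightarrow> (('n::finite) config \<Rightarrow> real) \<Rightarrow> 'n config \<Rightarrow> real" where
  "cond_E_mult s f \<psi> = E_prod s (\<lambda>\<xi>. f (config_mult \<psi> \<xi>))"

end

(* The inequality is proved one coordinate at a time. Splitting off a coordinate by the law of total
   variance, the between-slice part of the left-hand side equals the constant times that of the
   right-hand side, because thinning preserves slice means. For the within-slice part, the slice of
   the thinned function at psi_x = 1 is a convex combination of the thinned slices of f, so convexity
   of the variance reduces it to the induction hypothesis. *)
theory Submission
  imports Defs
begin

lemma variance_pmf_finite:
  fixes g :: "'a \<Rightarrow> real"
  assumes "finite (set_pmf M)"
  shows "measure_pmf.variance M g =
    measure_pmf.expectation M (\<lambda>x. (g x)\<^sup>2) - (measure_pmf.expectation M g)\<^sup>2"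
  by (rule measure_pmf.variance_eq) (auto intro: integrable_measure_pmf_finite assms)

text \<open>Centring is linear, so the claim follows by applying the convexity of the square
  pointwise to the centred functions.\<close>

lemma variance_pmf_convex:
  fixes g h :: "'a \<Rightarrow> real"
  assumes "finite (set_pmf M)" and s: "0 \<le> s" "s \<le> 1"
  shows "measure_pmf.variance M (\<lambda>x. s * g x + (1 - s) * h x) \<le>
    s * measure_pmf.variance M g + (1 - s) * measure_pmf.variance M h"
proof -
  note [simp] = integrable_measure_pmf_finite[OF assms(1)]
  let ?E = "measure_pmf.expectation M"
  have square_convex: "(s * a + (1 - s) * b)\<^sup>2 \<le> s * a\<^sup>2 + (1 - s) * b\<^sup>2" for a b :: real
  proof -
    have "s * a\<^sup>2 + (1 - s) * b\<^sup>2 - (s * a + (1 - s) * b)\<^sup>2 = s * (1 - s) * (a - b)\<^sup>2"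
      by (simp add: power2_eq_square algebra_simps)
    also have "\<dots> \<ge> 0" using s by simp
    finally show ?thesis by simp
  qed
  have "measure_pmf.variance M (\<lambda>x. s * g x + (1 - s) * h x)
      = ?E (\<lambda>x. (s * (g x - ?E g) + (1 - s) * (h x - ?E h))\<^sup>2)"
    by (simp add: algebra_simps)
  also have "\<dots> \<le> ?E (\<lambda>x. s * (g x - ?E g)\<^sup>2 + (1 - s) * (h x - ?E h)\<^sup>2)"
    by (intro integral_mono) (simp_all only: square_convex integrable_measure_pmf_finite[OF assms(1)])
  also have "\<dots> = s * measure_pmf.variance M g + (1 - s) * measure_pmf.variance M h"
    by simp
  finally show ?thesis .
qed

text \<open>The coordinate set is a parameter, unlike in \<open>prod_bernoulli\<close>, so that
  induction over finite sets is available; coordinates outside \<open>A\<close> are frozen at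
  \<open>False\<close>.\<close>

definition bernoulli_on :: "'a set \<Rightarrow> real \<Rightarrow> 'a config pmf" where
  "bernoulli_on A q = Pi_pmf A False (\<lambda>_. bernoulli_pmf q)"

definition thin_on :: "'a set \<Rightarrow> real \<Rightarrow> ('a config \<Rightarrow> real) \<Rightarrow> 'a config \<Rightarrow> real" where
  "thin_on A s f \<psi> = measure_pmf.expectation (bernoulli_on A s) (\<lambda>\<xi>. f (config_mult \<psi> \<xi>))"

lemma finite_set_bernoulli_on:
  assumes "finite A"
  shows "finite (set_pmf (bernoulli_on A q))"
  using assms by (auto simp: bernoulli_on_def set_Pi_pmf intro!: finite_PiE_dflt)

lemma expectation_bernoulli_on_insert:
  fixes g :: "'a config \<Rightarrow> real"
  assumes "finite A" "x \<notin> A" "0 \<le> q" "q \<le> 1"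
  shows "measure_pmf.expectation (bernoulli_on (insert x A) q) g =
    q * measure_pmf.expectation (bernoulli_on A q) (\<lambda>\<zeta>. g (\<zeta>(x := True))) +
    (1 - q) * measure_pmf.expectation (bernoulli_on A q) (\<lambda>\<zeta>. g (\<zeta>(x := False)))"
proof -
  have "bernoulli_on (insert x A) q =
      bind_pmf (bernoulli_pmf q) (\<lambda>b. map_pmf (\<lambda>\<zeta>. \<zeta>(x := b)) (bernoulli_on A q))"
    using assms by (simp add: bernoulli_on_def Pi_pmf_insert' map_pmf_def)
  moreover have "measure_pmf.expectation
      (bind_pmf (bernoulli_pmf q) (\<lambda>b. map_pmf (\<lambda>\<zeta>. \<zeta>(x := b)) (bernoulli_on A q))) g =
      (\<Sum>b\<in>UNIV. pmf (bernoulli_pmf q) b *\<^sub>R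
        measure_pmf.expectation (map_pmf (\<lambda>\<zeta>. \<zeta>(x := b)) (bernoulli_on A q)) g)"
    using finite_set_bernoulli_on[OF assms(1), of q] by (intro pmf_expectation_bind) auto
  ultimately show ?thesis
    using assms by (simp add: UNIV_bool)
qed

text \<open>Law of total variance, conditioning on coordinate \<open>x\<close>: the last summand is
  the variance of the slice mean, which takes two values with probabilities \<open>q\<close> and
  \<open>1 - q\<close>.\<close>

lemma variance_bernoulli_on_insert:
  fixes g :: "'a config \<Rightarrow> real"
  assumes "finite A" "x \<notin> A" "0 \<le> q" "q \<le> 1"
  shows "measure_pmf.variance (bernoulli_on (insert x A) q) g =
    q * measure_pmf.variance (bernoulli_on A q) (\<lambda>\<zeta>. g (\<zeta>(x := True))) +
    (1 - q) * measure_pmf.variance (bernoulli_on A q) (\<lambda>\<zeta>. g (\<zeta>(x := False))) +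
    q * (1 - q) * (measure_pmf.expectation (bernoulli_on A q) (\<lambda>\<zeta>. g (\<zeta>(x := True))) -
      measure_pmf.expectation (bernoulli_on A q) (\<lambda>\<zeta>. g (\<zeta>(x := False))))\<^sup>2"
proof -
  have fin: "finite (set_pmf (bernoulli_on A q))" "finite (set_pmf (bernoulli_on (insert x A) q))"
    using assms by (simp_all add: finite_set_bernoulli_on)
  \<comment> \<open>Passing to second moments first removes the mean from inside the expectation, so
    that the slice formula applies to the square of \<open>g\<close> and to \<open>g\<close>
    separately.\<close>
  show ?thesis
    by (simp only: variance_pmf_finite[OF fin(1)] variance_pmf_finite[OF fin(2)])
      (simp add: expectation_bernoulli_on_insert[OF assms] power2_eq_square algebra_simps)
qed

lemma config_mult_fun_upd:
  "config_mult (\<psi>(x := b)) (\<xi>(x := c)) = (config_mult \<psi> \<xi>)(x := b \<and> c)"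
  by (auto simp: config_mult_def)

text \<open>If \<open>\<psi>\<close> is \<open>True\<close> at \<open>x\<close>, the product there
  equals \<open>\<xi> x\<close>, which selects the slice; if it is \<open>False\<close>, both values
  of \<open>\<xi> x\<close> lead to the \<open>False\<close> slice.\<close>

lemma thin_on_insert:
  assumes "finite A" "x \<notin> A" "0 \<le> s" "s \<le> 1"
  shows "thin_on (insert x A) s f (\<psi>(x := True)) =
      s * thin_on A s (\<lambda>\<zeta>. f (\<zeta>(x := True))) \<psi> +
      (1 - s) * thin_on A s (\<lambda>\<zeta>. f (\<zeta>(x := False))) \<psi>"
    and "thin_on (insert x A) s f (\<psi>(x := False)) = thin_on A s (\<lambda>\<zeta>. f (\<zeta>(x := False))) \<psi>"
  by (simp_all add: thin_on_def expectation_bernoulli_on_insert[OF assms] config_mult_fun_upd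
      algebra_simps)

text \<open>The conjunction of independent Bernoulli variables with parameters \<open>r\<close> and
  \<open>s\<close> is Bernoulli with parameter \<open>r * s\<close>, so the coordinate-wise product
  has law \<open>bernoulli_on A (r * s)\<close>.\<close>

lemma expectation_thin_on:
  fixes f :: "'a config \<Rightarrow> real"
  assumes "finite A" "0 \<le> r" "r \<le> 1" "0 \<le> s" "s \<le> 1"
  shows "measure_pmf.expectation (bernoulli_on A r) (thin_on A s f) =
    measure_pmf.expectation (bernoulli_on A (r * s)) f"
  using assms(1)
proof (induction A arbitrary: f rule: finite_induct)
  case empty
  show ?case by (simp add: bernoulli_on_def thin_on_def config_mult_def)
next
  case (insert x A)
  note [simp] = integrable_measure_pmf_finite[OF finite_set_bernoulli_on[OF insert.hyps(1)]]
  have "0 \<le> r * s" "r * s \<le> 1" using assms by (auto intro: mult_le_one)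
  then show ?case
    using assms(2-) insert
    by (simp add: expectation_bernoulli_on_insert thin_on_insert algebra_simps)
qed

lemma variance_thin_on_le:
  fixes f :: "'a config \<Rightarrow> real" and p r :: real
  assumes "finite A" and pr: "0 < p" "p < r" "r < 1"
  shows "measure_pmf.variance (bernoulli_on A r) (thin_on A (p / r) f) \<le>
    (p / r) * ((1 - r) / (1 - p)) * measure_pmf.variance (bernoulli_on A p) f"
  using assms(1)
\<comment> \<open>The function varies because the induction hypothesis is needed for both slices
  \<open>f0\<close> and \<open>f1\<close>.\<close>
proof (induction A arbitrary: f rule: finite_induct)
  case empty
  show ?case by (simp add: bernoulli_on_def)
next
  case (insert x A)
  define s c where "s = p / r" and "c = (p / r) * ((1 - r) / (1 - p))"
  have s: "0 \<le> s" "s \<le> 1" "r * s = p" using pr by (simp_all add: s_def)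
  have r: "0 \<le> r" "r \<le> 1" and p: "0 \<le> p" "p \<le> 1" using pr by simp_all
  note fin = finite_set_bernoulli_on[OF insert.hyps(1)]
  note [simp] = integrable_measure_pmf_finite[OF fin]
  let ?E = "\<lambda>q. measure_pmf.expectation (bernoulli_on A q)"
  let ?V = "\<lambda>q g. measure_pmf.variance (bernoulli_on A q) g"
  define f0 f1 where "f0 = (\<lambda>\<zeta>. f (\<zeta>(x := False)))" and "f1 = (\<lambda>\<zeta>. f (\<zeta>(x := True)))"
  define g0 g1 where "g0 = thin_on A s f0" and "g1 = thin_on A s f1"
  have E0: "?E r g0 = ?E p f0" and E1: "?E r g1 = ?E p f1"
    using expectation_thin_on[OF insert.hyps(1) r s(1,2)] by (simp_all add: g0_def g1_def s(3))
  have V0: "?V r g0 \<le> c * ?V p f0" and V1: "?V r g1 \<le> c * ?V p f1"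
    using insert.IH by (simp_all add: g0_def g1_def s_def c_def)
  \<comment> \<open>This identity dictates the constant \<open>c\<close>: it makes the between-slice
    terms agree exactly, so equality holds when \<open>f\<close> depends on the coordinate
    \<open>x\<close> alone.\<close>
  have const: "r * (1 - r) * s\<^sup>2 = c * (p * (1 - p))"
    using pr by (simp add: s_def c_def power2_eq_square field_simps)
  have "measure_pmf.variance (bernoulli_on (insert x A) r) (thin_on (insert x A) s f)
      = r * ?V r (\<lambda>\<psi>. s * g1 \<psi> + (1 - s) * g0 \<psi>) + (1 - r) * ?V r g0
        + r * (1 - r) * (?E r (\<lambda>\<psi>. s * g1 \<psi> + (1 - s) * g0 \<psi>) - ?E r g0)\<^sup>2"
    unfolding variance_bernoulli_on_insert[OF insert.hyps r] thin_on_insert[OF insert.hyps s(1,2)]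
      g0_def g1_def f0_def f1_def by (rule refl)
  also have "\<dots> \<le> r * (s * ?V r g1 + (1 - s) * ?V r g0) + (1 - r) * ?V r g0
        + r * (1 - r) * (?E r (\<lambda>\<psi>. s * g1 \<psi> + (1 - s) * g0 \<psi>) - ?E r g0)\<^sup>2"
    using variance_pmf_convex[OF fin s(1,2)] r(1) by (intro add_right_mono mult_left_mono)
  \<comment> \<open>Mixing with \<open>g0\<close> shrinks the gap between slice means by the factor
    \<open>s\<close>, whose square enters \<open>const\<close>.\<close>
  also have "?E r (\<lambda>\<psi>. s * g1 \<psi> + (1 - s) * g0 \<psi>) - ?E r g0 = s * (?E p f1 - ?E p f0)"
    by (simp add: E0 E1 algebra_simps)
  also have "r * (1 - r) * (s * (?E p f1 - ?E p f0))\<^sup>2 =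
      c * (p * (1 - p) * (?E p f1 - ?E p f0)\<^sup>2)"
    by (simp only: power_mult_distrib mult.assoc[symmetric] const)
  \<comment> \<open>The \<open>False\<close> slice collects the weight
    \<open>r * (1 - s) + (1 - r)\<close>, so as \<open>r * s = p\<close> the weights become
    \<open>p\<close> and \<open>1 - p\<close>, those of the slices under parameter
    \<open>p\<close>.\<close>
  also have "r * (s * ?V r g1 + (1 - s) * ?V r g0) + (1 - r) * ?V r g0 =
      r * s * ?V r g1 + (1 - r * s) * ?V r g0"
    by (simp only: ring_distribs mult.assoc)
  also have "\<dots> \<le> p * (c * ?V p f1) + (1 - p) * (c * ?V p f0)"
    unfolding s(3) using V0 V1 p by (intro add_mono mult_left_mono) simp_all
  also have "p * (c * ?V p f1) + (1 - p) * (c * ?V p f0)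
      + c * (p * (1 - p) * (?E p f1 - ?E p f0)\<^sup>2)
      = c * measure_pmf.variance (bernoulli_on (insert x A) p) f"
    unfolding variance_bernoulli_on_insert[OF insert.hyps p] f0_def f1_def
    by (simp only: ring_distribs mult.left_commute[of c])
  finally show ?case by (simp add: s_def c_def)
qed

theorem theorem1:
  fixes f :: "('n::finite) config \<Rightarrow> real" and p r :: real
  assumes "0 < p" and "p < r" and "r < 1"
  shows "Var_prod r (cond_E_mult (p / r) f) \<le> (p / r) * ((1 - r) / (1 - p)) * Var_prod p f"
proof -
  have "prod_bernoulli q = bernoulli_on (UNIV :: 'n set) q" for q
    by (simp add: prod_bernoulli_def bernoulli_on_def)
  moreover from this have "cond_E_mult s f = thin_on UNIV s f" for s
    by (auto simp: cond_E_mult_def thin_on_def)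
  ultimately show ?thesis
    using variance_thin_on_le[OF finite assms] by metis
qed

end
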